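(* Let $n$ be an odd positive integer with $n>M_8^2$, where $M_8$ is defined in the context. Then $u(\zeta)\ne0$ for every primitive $n$-th root of unity $\zeta$.
   Context: Notation: $(a;q)_0=1$, $(a;q)_k=\prod_{j=0}^{k-1}(1-aq^j)$. A primitive $n$-th root of unity is a complex $\zeta$ with $\zeta^n=1$ and $\zeta^m\ne1$ for $0<m<n$. Ramanujan's second order mock theta function is $u(q)=\sum_{k\ge0}\frac{(-1)^k q^{k^2}(q;q^2)_k}{(-q^2;q^2)_k^2}$ for $|q|<1$. For a root of unity $\zeta$ of odd order, substituting $q=\zeta$ gives a series with nonzero denominators whose terms vanish for all large $k$. $u(\zeta)$ denotes this finite sum. For a root of unity $\zeta$ of odd order let $M_{8,\zeta}=\sup_{0\le r<1}|u(r\zeta)|$, and let $M_8=\inf\{M_{8,\zeta}:\ \zeta\text{ a primitive root of unity of odd order}\}$. *)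

theory Defs
  imports "HOL-Analysis.Analysis"
begin

definition qpoch :: "complex \<Rightarrow> complex \<Rightarrow> nat \<Rightarrow> complex" where
  "qpoch a q k = (\<Prod>j<k. 1 - a * q ^ j)"

definition primitive_root_of_unity :: "nat \<Rightarrow> complex \<Rightarrow> bool" where
  "primitive_root_of_unity n \<zeta> \<longleftrightarrow>
     n > 0 \<and> \<zeta> ^ n = 1 \<and> (\<forall>m. 0 < m \<and> m < n \<longrightarrow> \<zeta> ^ m \<noteq> 1)"

definition u_term :: "complex \<Rightarrow> nat \<Rightarrow> complex" where
  "u_term q k =
     (-1) ^ k * q ^ (k\<^sup>2) * qpoch q (q\<^sup>2) k / (qpoch (- (q\<^sup>2)) (q\<^sup>2) k)\<^sup>2"

text \<open>
  The series is used both for \<open>|q| < 1\<close> and at roots of unity of odd order. In the latter case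
  all denominators are nonzero and only finitely many terms are nonzero, so that the infinite sum
  is the finite sum; see \<open>u_denominator_nonzero\<close> and \<open>mock_u_root_of_unity\<close> below.
\<close>
definition mock_u :: "complex \<Rightarrow> complex" where
  "mock_u q = (\<Sum>k. u_term q k)"

text \<open>
  The supremum and the infimum are taken in the extended reals: a real-valued supremum of an
  unbounded set would be an unspecified number.
\<close>
definition M8_at :: "complex \<Rightarrow> ereal" where
  "M8_at \<zeta> = (SUP r\<in>{0..<1::real}. ereal (norm (mock_u (of_real r * \<zeta>))))"

definition M8 :: ereal where
  "M8 = (INF \<zeta>\<in>{\<zeta>. \<exists>n. odd n \<and> primitive_root_of_unity n \<zeta>}. M8_at \<zeta>)"

lemma u_denominator_nonzero:
  assumes "odd n" "primitive_root_of_unity n \<zeta>"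
  shows "qpoch (- (\<zeta>\<^sup>2)) (\<zeta>\<^sup>2) k \<noteq> 0"
proof -
  have "1 + \<zeta>\<^sup>2 * (\<zeta>\<^sup>2) ^ j \<noteq> 0" for j
  proof
    assume "1 + \<zeta>\<^sup>2 * (\<zeta>\<^sup>2) ^ j = 0"
    hence "\<zeta> ^ (2 * Suc j) = - 1"
      by (simp add: power_mult add_eq_0_iff power2_eq_square mult.assoc)
    hence "(\<zeta> ^ (2 * Suc j)) ^ n = - 1"
      using assms(1) by simp
    moreover have "(\<zeta> ^ (2 * Suc j)) ^ n = (\<zeta> ^ n) ^ (2 * Suc j)"
      by (simp only: power_mult [symmetric] mult.commute)
    ultimately show False
      using assms(2) by (simp add: primitive_root_of_unity_def)
  qed
  thus ?thesis
    by (simp add: qpoch_def)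
qed

lemma mock_u_root_of_unity:
  assumes "odd n" "primitive_root_of_unity n \<zeta>"
  shows "mock_u \<zeta> = (\<Sum>k\<le>(n - 1) div 2. u_term \<zeta> k)"
  unfolding mock_u_def
proof (rule suminf_finite)
  fix k assume "k \<notin> {..(n - 1) div 2}"
  hence k: "(n - 1) div 2 < k" by simp
  have "\<zeta> * (\<zeta>\<^sup>2) ^ ((n - 1) div 2) = \<zeta> ^ Suc (2 * ((n - 1) div 2))"
    by (simp add: power_mult)
  also have "Suc (2 * ((n - 1) div 2)) = n"
    using assms(1) by (auto elim!: oddE)
  finally have "1 - \<zeta> * (\<zeta>\<^sup>2) ^ ((n - 1) div 2) = 0"
    using assms(2) by (simp add: primitive_root_of_unity_def)
  hence "qpoch \<zeta> (\<zeta>\<^sup>2) k = 0"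
    unfolding qpoch_def using k by (intro prod_zero) auto
  thus "u_term \<zeta> k = 0"
    by (simp add: u_term_def)
qed simp

end

theory Submission
  imports Defs
begin

text \<open>
  Let \<open>m = (n - 1) / 2\<close> and \<open>p = \<zeta>\<^sup>2\<close>, so that \<open>\<zeta> = p\<^sup>-\<^sup>m\<close>. Then the \<open>k\<close>-th term of
  \<open>u(\<zeta>)\<close> is \<open>p^(k\<^sup>2) [m, k] (p; p)\<^sub>k / (-p; p)\<^sub>k\<^sup>2\<close>, with \<open>[m, k]\<close> the Gaussian binomial coefficient.
  The factors \<open>1 + p^j\<close> are units of \<open>\<int>[\<zeta>]\<close> because \<open>n\<close> is odd, and \<open>(p; p)\<^sub>k\<close> is congruent to
  \<open>(-p; p)\<^sub>k\<close> modulo 2. Hence \<open>u(\<zeta>)\<close> is congruent modulo 2 to the sum over \<open>k\<close> of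
  \<open>(-1)^k p^(k\<^sup>2) [m, k] / (-p; p)\<^sub>k\<close>, which equals \<open>1 / (-p; p)\<^sub>m\<close> by a summation formula of Cauchy.
  So \<open>u(\<zeta>)\<close> is a unit modulo 2, and it is nonzero because 2 is not invertible in \<open>\<int>[\<zeta>]\<close>.
\<close>

section \<open>Gaussian binomial coefficients\<close>

text \<open>Pascal's recursion makes this an integer polynomial in \<open>p\<close>. It thus makes
  sense at roots of unity, where the usual quotient of products can be 0/0, and it stays in every
  ring containing \<open>p\<close>.\<close>

fun gauss_binomial :: "'a::comm_ring_1 \<Rightarrow> nat \<Rightarrow> nat \<Rightarrow> 'a" where
  "gauss_binomial p m 0 = 1"
| "gauss_binomial p 0 (Suc k) = 0"
| "gauss_binomial p (Suc m) (Suc k) = gauss_binomial p m k + p ^ Suc k * gauss_binomial p m (Suc k)"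

lemma gauss_binomial_eq_0: "m < k \<Longrightarrow> gauss_binomial p m k = 0"
  by (induction p m k rule: gauss_binomial.induct) auto

text \<open>The classical quotient formula with the denominator cleared, by induction along Pascal's
  recursion.\<close>

lemma gauss_binomial_prod:
  "gauss_binomial p m k * (\<Prod>j<k. 1 - p ^ Suc j) = (\<Prod>j<k. 1 - p ^ (m - j))"
proof (induction m arbitrary: k)
  case 0
  show ?case by (cases k) (auto simp: prod.lessThan_Suc_shift simp del: prod.lessThan_Suc)
next
  case (Suc m)
  show ?case
  proof (cases k)
    case 0
    thus ?thesis by simp
  next
    case k: (Suc l)
    have "gauss_binomial p (Suc m) k * (\<Prod>j<k. 1 - p ^ Suc j) =
        (gauss_binomial p m l * (\<Prod>j<l. 1 - p ^ Suc j)) * (1 - p ^ Suc l)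
        + p ^ Suc l * (gauss_binomial p m (Suc l) * (\<Prod>j<Suc l. 1 - p ^ Suc j))"
      unfolding k by (simp add: algebra_simps)
    also have "\<dots> = (\<Prod>j<l. 1 - p ^ (m - j)) * (1 - p ^ Suc l)
        + p ^ Suc l * ((\<Prod>j<l. 1 - p ^ (m - j)) * (1 - p ^ (m - l)))"
      unfolding Suc.IH by simp
    also have "\<dots> = (\<Prod>j<l. 1 - p ^ (m - j)) * (1 - p ^ (Suc l + (m - l)))"
      by (simp add: algebra_simps power_add)
    also have "\<dots> = (\<Prod>j<l. 1 - p ^ (m - j)) * (1 - p ^ Suc m)"
    proof (cases "l \<le> m")
      case True
      thus ?thesis by simp
    next
      \<comment> \<open>Subtraction truncates here, so the exponent is only \<open>Suc l\<close>;
        but the product contains the factor \<open>j = m\<close>, which is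
        \<open>1 - p ^ 0 = 0\<close>.\<close>
      case False
      hence "(\<Prod>j<l. 1 - p ^ (m - j)) = 0"
        using prod_zero[of "{..<l}" "\<lambda>j. 1 - p ^ (m - j)"] by (metis finite_lessThan lessThan_iff
            not_le diff_self_eq_0 power_0 diff_self)
      thus ?thesis by simp
    qed
    also have "\<dots> = (\<Prod>j<k. 1 - p ^ (Suc m - j))"
      unfolding k by (subst prod.lessThan_Suc_shift) (simp add: mult.commute)
    finally show ?thesis .
  qed
qed

section \<open>Cauchy's summation formula\<close>

lemma qpoch_Suc: "qpoch a q (Suc k) = qpoch a q k * (1 - a * q ^ k)"
  by (simp add: qpoch_def)

lemma qpoch_Suc_shift: "qpoch a q (Suc k) = (1 - a) * qpoch (a * q) q k"
  unfolding qpoch_def by (subst prod.lessThan_Suc_shift) (simp add: mult.assoc)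

text \<open>Induction on \<open>m\<close>, passing from \<open>c\<close> to \<open>c * p\<close>.
  Pascal's recursion yields two contributions of each \<open>gauss_binomial p m k\<close>; they
  merge into one term of the sum for \<open>c * p\<close>, divided by \<open>1 - c\<close>.\<close>

lemma cauchy_sum:
  assumes "\<And>j. c * p ^ j \<noteq> 1"
  shows "(\<Sum>k\<le>m. gauss_binomial p m k * p ^ (k * (k - 1)) * c ^ k / qpoch c p k) = 1 / qpoch c p m"
  using assms
proof (induction m arbitrary: c)
  case 0
  show ?case by (simp add: qpoch_def)
next
  case (Suc m)
  have nz: "1 - c * p ^ k \<noteq> 0" for k using Suc.prems[of k] by simp
  have nzq: "qpoch c p k \<noteq> 0" for k using nz by (simp add: qpoch_def)
  have step: "gauss_binomial p m k * p ^ (k * k) * c ^ k / qpoch c p k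
      + gauss_binomial p m k * p ^ (Suc k * k) * c ^ Suc k / qpoch c p (Suc k)
      = gauss_binomial p m k * p ^ (k * (k - 1)) * (c * p) ^ k / qpoch (c * p) p k / (1 - c)" for k
  proof -
    have "k * k = k * (k - 1) + k" by (cases k) auto
    hence e: "p ^ (k * k) = p ^ (k * (k - 1)) * p ^ k" by (metis power_add)
    have e2: "p ^ (Suc k * k) = p ^ (k * k) * p ^ k" by (simp add: power_add mult.commute)
    \<comment> \<open>Over the common denominator the numerators \<open>1 - c * p ^ k\<close> and
      \<open>c * p ^ k\<close> add up to 1.\<close>
    have "gauss_binomial p m k * p ^ (k * k) * c ^ k / qpoch c p k
      + gauss_binomial p m k * p ^ (Suc k * k) * c ^ Suc k / qpoch c p (Suc k)
      = gauss_binomial p m k * p ^ (k * k) * c ^ k / qpoch c p (Suc k)"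
      unfolding e2 qpoch_Suc using nz[of k] nzq[of k] by (simp add: divide_simps) (simp add: algebra_simps)
    also have "\<dots> = gauss_binomial p m k * p ^ (k * (k - 1)) * (c * p) ^ k / qpoch (c * p) p k / (1 - c)"
      unfolding qpoch_Suc_shift e by (simp add: power_mult_distrib mult_ac)
    finally show ?thesis .
  qed
  \<comment> \<open>The shift uses \<open>Suc k + Suc k * k = Suc k * Suc k\<close>, and the 1 is
    the term at 0. The term at \<open>Suc m\<close> vanishes and is dropped later.\<close>
  have top: "(\<Sum>k\<le>m. p ^ Suc k * gauss_binomial p m (Suc k) * p ^ (Suc k * k) * c ^ Suc k / qpoch c p (Suc k))
     + 1 = (\<Sum>k\<le>Suc m. gauss_binomial p m k * p ^ (k * k) * c ^ k / qpoch c p k)"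
    by (subst sum.atMost_Suc_shift)
       (auto simp: qpoch_def power_add mult_ac intro!: sum.cong simp del: sum.atMost_Suc)
  have "(\<Sum>k\<le>Suc m. gauss_binomial p (Suc m) k * p ^ (k * (k - 1)) * c ^ k / qpoch c p k) =
      1 + (\<Sum>k\<le>m. gauss_binomial p (Suc m) (Suc k) * p ^ (Suc k * k) * c ^ Suc k / qpoch c p (Suc k))"
    by (subst sum.atMost_Suc_shift) (simp add: qpoch_def)
  also have "\<dots> = (\<Sum>k\<le>m. gauss_binomial p m k * p ^ (Suc k * k) * c ^ Suc k / qpoch c p (Suc k))
     + ((\<Sum>k\<le>m. p ^ Suc k * gauss_binomial p m (Suc k) * p ^ (Suc k * k) * c ^ Suc k / qpoch c p (Suc k)) + 1)"
    by (simp only: gauss_binomial.simps distrib_right add_divide_distrib sum.distrib add_ac)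
  also have "\<dots> = (\<Sum>k\<le>m. gauss_binomial p m k * p ^ (k * k) * c ^ k / qpoch c p k
      + gauss_binomial p m k * p ^ (Suc k * k) * c ^ Suc k / qpoch c p (Suc k))"
    unfolding top by (simp add: gauss_binomial_eq_0 sum.distrib)
  also have "\<dots> = (\<Sum>k\<le>m. gauss_binomial p m k * p ^ (k * (k - 1)) * (c * p) ^ k / qpoch (c * p) p k) / (1 - c)"
    unfolding step sum_divide_distrib ..
  also have "\<dots> = 1 / qpoch (c * p) p m / (1 - c)"
    using Suc.prems[of "Suc _"] by (subst Suc.IH) (auto simp: mult.assoc)
  also have "\<dots> = 1 / qpoch c p (Suc m)"
    by (simp add: qpoch_Suc_shift mult.commute)
  finally show ?case .
qed

section \<open>Integral elements acting on a finite family\<close>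

text \<open>
  The elements \<open>x\<close> for which the \<open>\<int>\<close>-span of \<open>v 0, \<dots>, v (n - 1)\<close> is closed under multiplication
  by \<open>x\<close>; the integer matrix of that multiplication replaces the theory of algebraic integers.
\<close>
definition multipliers :: "nat \<Rightarrow> (nat \<Rightarrow> complex) \<Rightarrow> complex set" where
  "multipliers n v = {x. \<exists>A :: nat \<Rightarrow> nat \<Rightarrow> int. \<forall>i<n. x * v i = (\<Sum>j<n. of_int (A i j) * v j)}"

lemma multipliers_of_int: "of_int c \<in> multipliers n v"
proof -
  have "of_int c * v i = (\<Sum>j<n. of_int (if j = i then c else 0) * v j)" if "i < n" for i
    using that by (simp add: if_distrib if_distribR cong: if_cong)
  thus ?thesis
    unfolding multipliers_def by (intro CollectI exI[of _ "\<lambda>i j. if j = i then c else 0"]) blast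
qed

lemma multipliers_add:
  assumes "x \<in> multipliers n v" "y \<in> multipliers n v"
  shows "x + y \<in> multipliers n v"
proof -
  obtain A B :: "nat \<Rightarrow> nat \<Rightarrow> int" where
    "\<And>i. i < n \<Longrightarrow> x * v i = (\<Sum>j<n. of_int (A i j) * v j)"
    "\<And>i. i < n \<Longrightarrow> y * v i = (\<Sum>j<n. of_int (B i j) * v j)"
    using assms unfolding multipliers_def by blast
  hence "(x + y) * v i = (\<Sum>j<n. of_int (A i j + B i j) * v j)" if "i < n" for i
    using that by (simp add: distrib_right sum.distrib)
  thus ?thesis
    unfolding multipliers_def by (intro CollectI exI[of _ "\<lambda>i j. A i j + B i j"]) blast
qed

lemma multipliers_mult:
  assumes "x \<in> multipliers n v" "y \<in> multipliers n v"
  shows "x * y \<in> multipliers n v"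
proof -
  obtain A B :: "nat \<Rightarrow> nat \<Rightarrow> int" where
    A: "\<And>i. i < n \<Longrightarrow> x * v i = (\<Sum>j<n. of_int (A i j) * v j)" and
    B: "\<And>i. i < n \<Longrightarrow> y * v i = (\<Sum>j<n. of_int (B i j) * v j)"
    using assms unfolding multipliers_def by blast
  have "(x * y) * v i = (\<Sum>l<n. of_int (\<Sum>j<n. A i j * B j l) * v l)" if "i < n" for i
  proof -
    have "(x * y) * v i = y * (\<Sum>j<n. of_int (A i j) * v j)"
      using A[OF that] by (simp add: mult_ac)
    also have "\<dots> = (\<Sum>j<n. of_int (A i j) * (y * v j))"
      by (simp add: sum_distrib_left mult_ac)
    also have "\<dots> = (\<Sum>j<n. \<Sum>l<n. of_int (A i j) * (of_int (B j l) * v l))"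
      by (intro sum.cong) (simp_all add: B sum_distrib_left)
    also have "\<dots> = (\<Sum>l<n. of_int (\<Sum>j<n. A i j * B j l) * v l)"
      by (subst sum.swap) (simp add: sum_distrib_right mult.assoc)
    finally show ?thesis .
  qed
  thus ?thesis
    unfolding multipliers_def by (intro CollectI exI[of _ "\<lambda>i l. \<Sum>j<n. A i j * B j l"]) blast
qed

lemma multipliers_0: "0 \<in> multipliers n v" and multipliers_1: "1 \<in> multipliers n v"
  using multipliers_of_int[of 0] multipliers_of_int[of 1] by simp_all

lemma multipliers_uminus: "x \<in> multipliers n v \<Longrightarrow> - x \<in> multipliers n v"
  using multipliers_mult[OF multipliers_of_int[of "-1"]] by simp

lemma multipliers_diff:
  "x \<in> multipliers n v \<Longrightarrow> y \<in> multipliers n v \<Longrightarrow> x - y \<in> multipliers n v"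
  using multipliers_add[OF _ multipliers_uminus] by simp

lemma multipliers_power: "x \<in> multipliers n v \<Longrightarrow> x ^ k \<in> multipliers n v"
  by (induction k) (auto intro: multipliers_1 multipliers_mult)

lemma multipliers_sum: "(\<And>i. i \<in> I \<Longrightarrow> f i \<in> multipliers n v) \<Longrightarrow> sum f I \<in> multipliers n v"
  by (induction I rule: infinite_finite_induct) (auto intro: multipliers_0 multipliers_add)

lemma multipliers_prod: "(\<And>i. i \<in> I \<Longrightarrow> f i \<in> multipliers n v) \<Longrightarrow> prod f I \<in> multipliers n v"
  by (induction I rule: infinite_finite_induct) (auto intro: multipliers_1 multipliers_mult)

lemma multipliers_gauss_binomial:
  "p \<in> multipliers n v \<Longrightarrow> gauss_binomial p m k \<in> multipliers n v"
  by (induction p m k rule: gauss_binomial.induct)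
     (auto intro!: multipliers_0 multipliers_1 multipliers_add multipliers_mult multipliers_power
           simp del: power_Suc)

text \<open>
  Eliminating the last unknown without division preserves the shape of the matrix modulo 2.
\<close>
lemma odd_diagonal_kernel_trivial:
  fixes C :: "nat \<Rightarrow> nat \<Rightarrow> int" and v :: "nat \<Rightarrow> 'a::field_char_0"
  assumes "\<And>i j. i < n \<Longrightarrow> j < n \<Longrightarrow> odd (C i j) \<longleftrightarrow> i = j"
    and "\<And>i. i < n \<Longrightarrow> (\<Sum>j<n. of_int (C i j) * v j) = 0"
    and "i < n"
  shows "v i = 0"
  using assms
proof (induction n arbitrary: C i)
  case 0
  thus ?case by simp
next
  case (Suc n)
  define D where "D i j = C n n * C i j - C i n * C n j" for i j
  have sum: "(\<Sum>j<n. of_int (C i j) * v j) = - (of_int (C i n) * v n)" if "i < Suc n" for i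
    using Suc.prems(2)[OF that] by (simp add: add_eq_0_iff2)
  have small: "v j = 0" if "j < n" for j
  proof (rule Suc.IH[of D])
    show "odd (D i j) \<longleftrightarrow> i = j" if "i < n" "j < n" for i j
      using that Suc.prems(1)[of i j] Suc.prems(1)[of i n] Suc.prems(1)[of n j] Suc.prems(1)[of n n]
      by (auto simp: D_def)
    show "(\<Sum>j<n. of_int (D i j) * v j) = 0" if "i < n" for i
    proof -
      have "(\<Sum>j<n. of_int (D i j) * v j) =
          of_int (C n n) * (\<Sum>j<n. of_int (C i j) * v j) - of_int (C i n) * (\<Sum>j<n. of_int (C n j) * v j)"
        by (simp add: D_def left_diff_distrib sum_subtractf sum_distrib_left mult.assoc)
      also have "\<dots> = 0"
        using that by (simp add: sum)
      finally show ?thesis .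
    qed
  qed (fact that)
  have "C n n \<noteq> 0" using Suc.prems(1)[of n n] by auto
  moreover have "of_int (C n n) * v n = 0"
    using Suc.prems(2)[of n] small by simp
  ultimately have "v n = 0" by simp
  thus ?case using small Suc.prems(3) by (metis less_Suc_eq)
qed

text \<open>If \<open>A\<close> is the integer matrix of an inverse of 2, then
  \<open>I - 2 A\<close> annihilates \<open>v\<close>. It is the identity modulo 2, so elimination
  forces \<open>v = 0\<close>.\<close>

lemma two_not_unit_multipliers:
  assumes "x \<in> multipliers n v" "i < n" "v i \<noteq> 0"
  shows "2 * x \<noteq> 1"
proof
  assume x: "2 * x = 1"
  obtain A :: "nat \<Rightarrow> nat \<Rightarrow> int" where
    A: "\<And>i. i < n \<Longrightarrow> x * v i = (\<Sum>j<n. of_int (A i j) * v j)"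
    using assms unfolding multipliers_def by blast
  define C where "C i j = (if j = i then 1 else 0) - 2 * A i j" for i j
  have "v i = 0"
  proof (rule odd_diagonal_kernel_trivial[of n C])
    show "odd (C i j) \<longleftrightarrow> i = j" for i j by (auto simp: C_def)
    show "(\<Sum>j<n. of_int (C i j) * v j) = 0" if "i < n" for i
    proof -
      have "(\<Sum>j<n. of_int (C i j) * v j) =
          (\<Sum>j<n. (if j = i then v j else 0) - 2 * (of_int (A i j) * v j))"
        by (intro sum.cong) (auto simp: C_def algebra_simps)
      also have "\<dots> = v i - 2 * (x * v i)"
        using that by (simp add: sum_subtractf sum_distrib_left A)
      also have "\<dots> = 0"
        using x by (simp add: mult.assoc[symmetric])
      finally show ?thesis .
    qed
  qed (fact assms(2))
  thus False using assms(3) by simp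
qed

section \<open>Roots of unity as multipliers\<close>

text \<open>Multiplication by \<open>\<zeta>\<close> permutes the powers cyclically.\<close>

lemma root_of_unity_multipliers:
  assumes "\<zeta> ^ n = 1"
  shows "\<zeta> \<in> multipliers n (\<lambda>i. \<zeta> ^ i)"
proof -
  have "\<zeta> * \<zeta> ^ i = (\<Sum>j<n. of_int (if j = Suc i mod n then 1 else 0) * \<zeta> ^ j)" if "i < n" for i
  proof -
    have "\<zeta> * \<zeta> ^ i = \<zeta> ^ (Suc i mod n)"
      using that assms by (cases "Suc i = n") (auto simp flip: power_Suc)
    thus ?thesis
      using that by (simp add: if_distrib if_distribR cong: if_cong)
  qed
  thus ?thesis
    unfolding multipliers_def
    by (intro CollectI exI[of _ "\<lambda>i j. if j = Suc i mod n then 1 else 0"]) blast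
qed

text \<open>Since \<open>n + 1\<close> is even, the product is the geometric sum up to
  \<open>\<omega> ^ n\<close>. A full period sums to 0, which leaves
  \<open>\<omega> ^ n = 1\<close>. The inverse is thus an integer polynomial in
  \<open>\<omega>\<close>.\<close>

lemma inverse_one_plus_root_of_unity:
  fixes \<omega> :: complex
  assumes "odd n" "\<omega> ^ n = 1" "\<omega> \<noteq> 1"
  shows "(1 + \<omega>) * (\<Sum>i<(n + 1) div 2. \<omega> ^ (2 * i)) = 1"
proof -
  have "(1 + \<omega>) * (\<Sum>i<l. \<omega> ^ (2 * i)) = (\<Sum>i<2 * l. \<omega> ^ i)" for l
    by (induction l) (auto simp: algebra_simps)
  from this[of "(n + 1) div 2"]
  have "(1 + \<omega>) * (\<Sum>i<(n + 1) div 2. \<omega> ^ (2 * i)) = (\<Sum>i<Suc n. \<omega> ^ i)"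
    using assms(1) by simp
  also have "\<dots> = 1"
    using assms(2,3) geometric_sum[of \<omega> n] by simp
  finally show ?thesis .
qed

section \<open>Congruences modulo 2\<close>

lemma mult_congruence:
  assumes "a - b \<in> (*) 2 ` multipliers n v" "c \<in> multipliers n v"
  shows "a * c - b * c \<in> (*) 2 ` multipliers n v"
proof -
  obtain x where "x \<in> multipliers n v" "a - b = 2 * x" using assms(1) by auto
  moreover from this have "a * c - b * c = 2 * (x * c)" by (simp add: algebra_simps)
  ultimately show ?thesis using assms(2) by (auto intro: multipliers_mult)
qed

text \<open>The factors agree modulo 2 because signs do not matter there.\<close>

lemma prod_congruence:
  fixes x :: "nat \<Rightarrow> complex"
  assumes "\<And>j. x j \<in> multipliers n v"
  shows "(\<Prod>j<k. 1 - x j) - (\<Prod>j<k. 1 + x j) \<in> (*) 2 ` multipliers n v"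
proof (induction k)
  case 0
  show ?case using multipliers_0 by (force simp: image_iff)
next
  case (Suc k)
  let ?P = "\<Prod>j<k. 1 - x j" and ?Q = "\<Prod>j<k. 1 + x j"
  obtain y where y: "y \<in> multipliers n v" "?P - ?Q = 2 * y" using Suc by auto
  have "(\<Prod>j<Suc k. 1 - x j) - (\<Prod>j<Suc k. 1 + x j) = 2 * (y * (1 - x k) - ?Q * x k)"
    using y(2) by (simp add: algebra_simps)
  moreover have "y * (1 - x k) - ?Q * x k \<in> multipliers n v"
    using y(1) assms
    by (intro multipliers_diff multipliers_mult multipliers_prod multipliers_add multipliers_1)
  ultimately show ?case by blast
qed

section \<open>The values of the mock theta function\<close>

text \<open>Here \<open>\<zeta> ^ (2 * j + 1)\<close> is inverse to
  \<open>(\<zeta>\<^sup>2) ^ (m - j)\<close>. Extracting it from each numerator factor gives a sign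
  and, as the first \<open>k\<close> odd numbers sum to \<open>k\<^sup>2\<close>, the power
  \<open>\<zeta> ^ k\<^sup>2\<close>; \<open>gauss_binomial_prod\<close> rewrites the rest.\<close>

lemma u_term_root_of_unity:
  assumes "\<zeta> ^ (2 * m + 1) = 1" "k \<le> m"
  shows "u_term \<zeta> k = (\<zeta>\<^sup>2) ^ k\<^sup>2 * gauss_binomial (\<zeta>\<^sup>2) m k *
           (\<Prod>j<k. 1 - (\<zeta>\<^sup>2) ^ Suc j) / (qpoch (- (\<zeta>\<^sup>2)) (\<zeta>\<^sup>2) k)\<^sup>2"
proof -
  have "qpoch \<zeta> (\<zeta>\<^sup>2) k = (- 1) ^ k * \<zeta> ^ k\<^sup>2 * (\<Prod>j<k. 1 - (\<zeta>\<^sup>2) ^ (m - j))"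
    using assms(2)
  proof (induction k)
    case 0
    show ?case by (simp add: qpoch_def)
  next
    case (Suc k)
    have "\<zeta> ^ (2 * k + 1) * (\<zeta>\<^sup>2) ^ (m - k) = \<zeta> ^ (2 * k + 1 + 2 * (m - k))"
      by (simp only: power_add power_mult)
    also have "2 * k + 1 + 2 * (m - k) = 2 * m + 1" using Suc.prems by simp
    finally have e: "\<zeta> ^ (2 * k + 1) * (\<zeta>\<^sup>2) ^ (m - k) = 1" using assms(1) by (simp only:)
    have "1 - \<zeta> * (\<zeta>\<^sup>2) ^ k = 1 - \<zeta> ^ (2 * k + 1)" by (simp add: power_mult)
    also have "\<dots> = - (\<zeta> ^ (2 * k + 1)) * (1 - (\<zeta>\<^sup>2) ^ (m - k))"
      unfolding right_diff_distrib using e by simp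
    finally have f: "1 - \<zeta> * (\<zeta>\<^sup>2) ^ k = - (\<zeta> ^ (2 * k + 1)) * (1 - (\<zeta>\<^sup>2) ^ (m - k))" .
    have "(Suc k)\<^sup>2 = k\<^sup>2 + (2 * k + 1)" by (simp add: power2_eq_square)
    hence g: "\<zeta> ^ (Suc k)\<^sup>2 = \<zeta> ^ k\<^sup>2 * \<zeta> ^ (2 * k + 1)" by (simp only: power_add)
    show ?case
      using Suc unfolding qpoch_Suc f g by (simp add: mult_ac)
  qed
  hence "(- 1) ^ k * \<zeta> ^ k\<^sup>2 * qpoch \<zeta> (\<zeta>\<^sup>2) k =
      ((- 1) ^ k * (- 1) ^ k) * (\<zeta> ^ k\<^sup>2 * \<zeta> ^ k\<^sup>2) * (\<Prod>j<k. 1 - (\<zeta>\<^sup>2) ^ (m - j))"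
    by (simp only: mult_ac)
  also have "\<dots> = (\<zeta>\<^sup>2) ^ k\<^sup>2 * (\<Prod>j<k. 1 - (\<zeta>\<^sup>2) ^ (m - j))"
    by (simp add: power2_eq_square power_mult_distrib flip: power_mult_distrib[of "-1"])
  finally show ?thesis
    unfolding u_term_def by (simp only: gauss_binomial_prod[symmetric] mult.assoc)
qed

lemma mock_u_root_of_unity_nonzero:
  assumes "odd n" "primitive_root_of_unity n \<zeta>"
  shows "mock_u \<zeta> \<noteq> 0"
proof
  assume zero: "mock_u \<zeta> = 0"
  obtain m where m: "n = 2 * m + 1" using assms(1) by (elim oddE)
  define p where "p = \<zeta>\<^sup>2"
  let ?R = "multipliers n (\<lambda>i. \<zeta> ^ i)"
  let ?D = "qpoch (- p) p"
  have zn: "\<zeta> ^ n = 1" using assms(2) by (simp add: primitive_root_of_unity_def)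
  have R: "\<zeta> \<in> ?R" "p \<in> ?R"
    unfolding p_def using root_of_unity_multipliers[OF zn] by (auto intro: multipliers_power)
  have D: "?D k = (\<Prod>j<k. 1 + p ^ Suc j)" for k
    by (simp add: qpoch_def)
  have Dnz: "?D k \<noteq> 0" for k
    unfolding p_def by (rule u_denominator_nonzero[OF assms])
  have invD: "1 / ?D k \<in> ?R" if "k \<le> m" for k
  proof -
    have "1 / (1 + p ^ Suc j) \<in> ?R" if "j < k" for j
    proof -
      have "p ^ Suc j = \<zeta> ^ (2 * Suc j)" unfolding p_def by (simp only: power_mult)
      \<comment> \<open>The bound \<open>k \<le> m\<close> keeps the exponent below the order of
        \<open>\<zeta>\<close>, so primitivity applies.\<close>
      moreover have "2 * Suc j < n" using that \<open>k \<le> m\<close> m by simp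
      ultimately have "p ^ Suc j \<noteq> 1"
        using assms(2) by (simp add: primitive_root_of_unity_def del: power_Suc)
      moreover have "(p ^ Suc j) ^ n = 1"
        unfolding p_def using zn by (metis power_mult mult.commute power_one)
      ultimately have "(1 + p ^ Suc j) * (\<Sum>i<(n + 1) div 2. (p ^ Suc j) ^ (2 * i)) = 1"
        by (intro inverse_one_plus_root_of_unity assms(1))
      hence "1 / (1 + p ^ Suc j) = (\<Sum>i<(n + 1) div 2. (p ^ Suc j) ^ (2 * i))"
        by (metis mult_zero_left nonzero_eq_divide_eq mult.commute zero_neq_one)
      also have "\<dots> \<in> ?R"
        by (intro multipliers_sum multipliers_power R)
      finally show ?thesis .
    qed
    hence "(\<Prod>j<k. 1 / (1 + p ^ Suc j)) \<in> ?R"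
      by (intro multipliers_prod) auto
    thus ?thesis unfolding D by (simp add: prod_dividef)
  qed
  \<comment> \<open>Replacing the numerator product by \<open>?D k\<close> modulo 2 cancels one of
    the two denominators. The sign is inserted to match Cauchy's formula.\<close>
  let ?g = "\<lambda>k. (- 1) ^ k * p ^ k\<^sup>2 * gauss_binomial p m k / ?D k"
  have "\<exists>y\<in>?R. u_term \<zeta> k - ?g k = 2 * y" if "k \<le> m" for k
  proof -
    let ?c = "p ^ k\<^sup>2 * gauss_binomial p m k * (1 / ?D k)"
    have c: "?c \<in> ?R"
      by (intro multipliers_mult multipliers_power multipliers_gauss_binomial R invD that)
    have "(\<Prod>j<k. 1 - p ^ Suc j) - ?D k \<in> (*) 2 ` ?R"
      unfolding D by (intro prod_congruence multipliers_power R)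
    from mult_congruence[OF this multipliers_mult[OF c invD[OF that]]]
    obtain y where y: "y \<in> ?R"
      "(\<Prod>j<k. 1 - p ^ Suc j) * (?c * (1 / ?D k)) - ?D k * (?c * (1 / ?D k)) = 2 * y"
      by auto
    have "(\<Prod>j<k. 1 - p ^ Suc j) * (?c * (1 / ?D k)) = u_term \<zeta> k"
      using u_term_root_of_unity[of \<zeta> m k] zn that
      by (simp add: m p_def power2_eq_square[of "qpoch _ _ _"] mult_ac)
    moreover have "?D k * (?c * (1 / ?D k)) = ?c"
      using Dnz[of k] by simp
    ultimately have u: "u_term \<zeta> k - ?c = 2 * y"
      using y(2) by simp
    show ?thesis
    proof (cases "even k")
      case True
      thus ?thesis using u y(1) by auto
    next
      \<comment> \<open>For odd \<open>k\<close> the sign turns \<open>?c\<close> into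
        \<open>- ?c\<close>, a change by \<open>2 * ?c\<close>.\<close>
      case False
      hence "u_term \<zeta> k - ?g k = 2 * (y + ?c)"
        using u by (simp add: algebra_simps)
      thus ?thesis using multipliers_add[OF y(1) c] by blast
    qed
  qed
  then obtain y where y: "\<And>k. k \<le> m \<Longrightarrow> y k \<in> ?R" "\<And>k. k \<le> m \<Longrightarrow> u_term \<zeta> k - ?g k = 2 * y k"
    by metis
  \<comment> \<open>Cauchy's formula at \<open>c = - p\<close>, whose powers supply both the sign
    and the missing factor \<open>p ^ k\<close>.\<close>
  have "(\<Sum>k\<le>m. ?g k) = 1 / ?D m"
  proof -
    have ne: "(- p) * p ^ j \<noteq> 1" for j
      using Dnz[of "Suc j"] unfolding qpoch_Suc by (metis diff_self mult_zero_right)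
    have "?g k = gauss_binomial p m k * p ^ (k * (k - 1)) * (- p) ^ k / ?D k" for k
    proof -
      have "k\<^sup>2 = k * (k - 1) + k" by (cases k) (auto simp: power2_eq_square)
      hence "p ^ k\<^sup>2 = p ^ (k * (k - 1)) * p ^ k" by (simp only: power_add)
      thus ?thesis by (simp only: power_minus[of p] mult_ac)
    qed
    thus ?thesis using cauchy_sum[OF ne, of m] by (simp only:)
  qed
  moreover have "(\<Sum>k\<le>m. u_term \<zeta> k) = 0"
    using zero mock_u_root_of_unity[OF assms] by (simp add: m)
  moreover have "(\<Sum>k\<le>m. u_term \<zeta> k) - (\<Sum>k\<le>m. ?g k) = 2 * (\<Sum>k\<le>m. y k)"
    unfolding sum_subtractf[symmetric] sum_distrib_left by (intro sum.cong) (auto simp: y(2))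
  ultimately have "- (1 / ?D m) = 2 * (\<Sum>k\<le>m. y k)" by simp
  \<comment> \<open>Clearing the unit \<open>?D m\<close> exhibits an inverse of 2 among the
    multipliers.\<close>
  hence "2 * (- (\<Sum>k\<le>m. y k) * ?D m) = 1"
    using Dnz[of m] by (simp add: field_simps) (metis minus_minus)
  moreover have "- (\<Sum>k\<le>m. y k) * ?D m \<in> ?R"
    unfolding D
    by (intro multipliers_mult multipliers_uminus multipliers_sum multipliers_prod multipliers_add
          multipliers_1 multipliers_power R y(1)) auto
  moreover have "2 * x \<noteq> 1" if "x \<in> ?R" for x
    \<comment> \<open>Index 0 serves because \<open>\<zeta> ^ 0 = 1\<close> is nonzero.\<close>
    using two_not_unit_multipliers[OF that, of 0] m by simp
  ultimately show False by blast
qed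

theorem theorem2p8:
  fixes n :: nat
  assumes "odd n" and "ereal (real n) > M8 ^ 2"
  shows "\<forall>\<zeta>. primitive_root_of_unity n \<zeta> \<longrightarrow> mock_u \<zeta> \<noteq> 0"
  using mock_u_root_of_unity_nonzero[OF assms(1)] by blast

end
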